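(* Let $f:\mathbb{R}^n\to\mathbb{R}$ be an integrable log-concave function. There exists a unique ellipsoidal function $\mathcal{E}(f)$, of the form $\mathcal{E}(f)=\mathcal{E}^{t_0\Vert f\Vert_\infty}$ for some ellipsoid $\mathcal{E}\subseteq\mathbb{R}^n$ and some $t_0\in(0,1]$, such that (i) $\mathcal{E}(f)(x)\leq f(x)$ for every $x\in\mathbb{R}^n$, and (ii) $\displaystyle \int_{\mathbb{R}^n}\mathcal{E}(f)(x)\,dx=\max\left\{\int_{\mathbb{R}^n}\mathcal{E}^{a}(x)\,dx\,:\,\mathcal{E}^{a}\leq f\right\}$, where the maximum is over all ellipsoidal functions $\mathcal{E}^a$ (that is, over all ellipsoids $\mathcal{E}$ and all $a>0$) with $\mathcal{E}^a\le f$ pointwise.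
   Context: A function $f:\mathbb{R}^n\to\mathbb{R}$ is log-concave if $f=e^{-v}$ with $v:\mathbb{R}^n\to(-\infty,+\infty]$ convex. Integrable log-concave functions are assumed upper semicontinuous with $\int_{\mathbb{R}^n}f>0$, so that the level sets $\{x: f(x)\ge t\Vert f\Vert_\infty\}$, $t\in(0,1)$, are convex bodies (compact, convex, nonempty interior), and the one for $t=1$ is nonempty, compact and convex. $\Vert f\Vert_\infty=\sup f$. An ellipsoid is a set $\mathcal{E}=c+TB_2^n$ with $c\in\mathbb{R}^n$, $T\in GL(n)$, where $B_2^n$ is the closed Euclidean unit ball. An ellipsoidal function is a function $\mathcal{E}^a=a\chi_{\mathcal{E}}$, where $a>0$ and $\chi_{\mathcal{E}}$ is the characteristic function of an ellipsoid $\mathcal{E}$. *)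

theory Defs
  imports "HOL-Analysis.Analysis"
begin

text \<open>Convexity for functions with values in \<open>(-\<infinity>, +\<infinity>]\<close>; excluding \<open>-\<infinity>\<close> keeps the
  extended sum on the right-hand side away from \<open>-\<infinity> + \<infinity>\<close>, and \<open>0 * \<infinity> = 0\<close> in \<^typ>\<open>ereal\<close>
  makes the endpoint cases \<open>u = 0\<close> and \<open>u = 1\<close> trivial.\<close>

definition ereal_convex :: "('a::real_vector \<Rightarrow> ereal) \<Rightarrow> bool" where
  "ereal_convex v \<longleftrightarrow>
     (\<forall>x. v x \<noteq> - \<infinity>) \<and>
     (\<forall>x y u. 0 \<le> u \<and> u \<le> 1 \<longrightarrow>
        v ((1 - u) *\<^sub>R x + u *\<^sub>R y) \<le> ereal (1 - u) * v x + ereal u * v y)"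

text \<open>\<open>exp_uminus r\<close> is \<open>e\<close> to the power \<open>-r\<close> for \<open>r\<close> in \<open>(-\<infinity>, +\<infinity>]\<close>. The value at \<open>-\<infinity>\<close> is
  junk and never used.\<close>

definition exp_uminus :: "ereal \<Rightarrow> real" where
  "exp_uminus r = (if r = \<infinity> then 0 else exp (- real_of_ereal r))"

definition log_concave_fun :: "('a::real_vector \<Rightarrow> real) \<Rightarrow> bool" where
  "log_concave_fun f \<longleftrightarrow> (\<exists>v. ereal_convex v \<and> (\<forall>x. f x = exp_uminus (v x)))"

definition upper_semicontinuous :: "('a::topological_space \<Rightarrow> real) \<Rightarrow> bool" where
  "upper_semicontinuous f \<longleftrightarrow> (\<forall>x a. f x < a \<longrightarrow> (\<forall>\<^sub>F y in at x. f y < a))"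

text \<open>A supremum of reals, hence only meaningful for functions bounded above; log-concave
  integrable functions with positive integral are bounded above.\<close>

definition sup_norm :: "('a \<Rightarrow> real) \<Rightarrow> real" where
  "sup_norm f = (SUP x. f x)"

definition ellipsoid :: "(real ^ 'n) set \<Rightarrow> bool" where
  "ellipsoid E \<longleftrightarrow>
     (\<exists>c (T :: real ^ 'n ^ 'n). invertible T \<and> E = (\<lambda>x. c + T *v x) ` cball 0 1)"

definition ellipsoidal :: "(real ^ 'n) set \<Rightarrow> real \<Rightarrow> real ^ 'n \<Rightarrow> real" where
  "ellipsoidal E a = (\<lambda>x. a * indicator E x)"

definition ellipsoidal_function :: "(real ^ 'n \<Rightarrow> real) \<Rightarrow> bool" where
  "ellipsoidal_function g \<longleftrightarrow> (\<exists>E a. ellipsoid E \<and> 0 < a \<and> g = ellipsoidal E a)"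

definition is_maximum :: "real \<Rightarrow> real set \<Rightarrow> bool" where
  "is_maximum m S \<longleftrightarrow> m \<in> S \<and> (\<forall>s\<in>S. s \<le> m)"

end

theory Submission
  imports Defs
begin

text \<open>
An ellipsoidal function below \<open>f\<close> is given by a centre \<open>c\<close>, an invertible matrix \<open>T\<close> and a height \<open>a\<close> with
\<open>a \<le> f (c + T *v x)\<close> on the unit ball, and its integral is \<open>a * \<bar>det T\<bar>\<close> up to a constant.

\<^bold>\<open>Existence.\<close> The parameters of near-optimal ellipsoidal functions stay in a compact set. Their heights
are bounded above because \<open>f\<close> is bounded (\<open>bdd_above_range\<close>), and bounded away from \<open>0\<close> because
the integral of \<open>min (f x) b\<close> tends to \<open>0\<close> with \<open>b\<close> by dominated convergence (\<open>integral_min_small\<close>). With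
the height bounded below, the ellipsoids lie in a superlevel set \<open>{y. b \<le> f y}\<close>, which is bounded
since otherwise \<open>f\<close> would dominate ellipsoidal functions of a fixed height and arbitrarily large volume (\<open>bounded_superlevel\<close>). Upper
semicontinuity makes the constraint closed, so the maximum is attained
(\<open>maximal_inscribed_exists\<close>).

\<^bold>\<open>Uniqueness.\<close> The superlevel sets of \<open>f\<close> are convex, and log-concavity bounds \<open>f\<close> from below by
\<open>sqrt (a1 * a2)\<close> on the half sum of two ellipsoids on which \<open>f\<close> is at least \<open>a1\<close> and \<open>a2\<close>. By the
singular value decomposition, two ellipsoids are \<open>c1 + T B\<close> and \<open>c2 + T D B\<close> with \<open>D\<close> a positive diagonal
matrix and \<open>B\<close> the unit ball (\<open>simultaneous_diagonalization\<close>), and their half sum contains an ellipsoid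
with matrix \<open>T (1 + D) / 2\<close>. The arithmetic-geometric mean inequality on each axis then shows that two maximisers
have \<open>D = 1\<close> and equal heights. Two distinct translates at the same height are excluded because their
convex hull contains a longer ellipsoid (\<open>capsule_inscribed\<close>).

The same decomposition yields the volume \<open>\<bar>det T\<bar>\<close> of \<open>T B\<close> in units of the volume of \<open>B\<close>, once the
invariance of Lebesgue measure under isometries is known.
\<close>

section \<open>Isometries and the singular value decomposition\<close>


text \<open>An isometry takes balls to balls of the same radius, and Vitali's covering theorem fills an open
set with disjoint balls up to a null set.\<close>

lemma emeasure_isometric_image_open:
  fixes f :: "'a::euclidean_space \<Rightarrow> 'a"
  assumes f: "orthogonal_transformation f" and U: "open U"
  shows "emeasure lebesgue (f ` U) = emeasure lebesgue U"
proof -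
  have lin: "linear f" and inj: "inj f"
    using f orthogonal_transformation_linear orthogonal_transformation_inj by auto
  define K where "K = {(x, r). 0 < r \<and> ball x r \<subseteq> U}"
  have fine: "\<exists>i. i \<in> K \<and> x \<in> ball (fst i) (snd i) \<and> snd i < d" if "x \<in> U" "0 < d" for x d
  proof -
    obtain e where "e > 0" "ball x e \<subseteq> U"
      using U \<open>x \<in> U\<close> open_contains_ball by blast
    moreover have "ball x (min e (d/2)) \<subseteq> ball x e"
      by auto
    ultimately show ?thesis
      using \<open>0 < d\<close> by (intro exI[of _ "(x, min e (d/2))"]) (auto simp: K_def)
  qed
  obtain C where C: "countable C" "C \<subseteq> K"
      and pw: "pairwise (\<lambda>i j. disjnt (ball (fst i) (snd i)) (ball (fst j) (snd j))) C"
      and neg: "negligible (U - (\<Union>i\<in>C. ball (fst i) (snd i)))"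
    using Vitali_covering_theorem_balls[of U K fst snd, OF fine] by blast
  define B where "B i = ball (fst i) (snd i)" for i :: "'a \<times> real"
  define N where "N = U - (\<Union>i\<in>C. B i)"
  have N: "N \<in> null_sets lebesgue" "f ` N \<in> null_sets lebesgue"
    using neg negligible_differentiable_image_negligible[OF _ neg linear_imp_differentiable_on[OF lin]]
    by (auto simp: N_def B_def negligible_iff_null_sets)
  have Usplit: "U = (\<Union>i\<in>C. B i) \<union> N"
    using C(2) unfolding K_def N_def B_def by fastforce
  then have fUsplit: "f ` U = (\<Union>i\<in>C. f ` B i) \<union> f ` N"
    by blast
  have fB: "f ` B i = ball (f (fst i)) (snd i)" for i
    using f by (simp add: B_def image_orthogonal_transformation_ball)
  have disj: "disjoint_family_on B C"
    using pw by (auto simp: disjoint_family_on_def pairwise_def disjnt_def B_def)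
  have disj': "disjoint_family_on (\<lambda>i. f ` B i) C"
    using disj inj by (simp add: disjoint_family_on_def image_Int[symmetric])
  have eqB: "emeasure lebesgue (f ` B i) = emeasure lebesgue (B i)" if "i \<in> C" for i
  proof -
    have "0 \<le> snd i"
      using that C(2) by (auto simp: K_def)
    then show ?thesis
      unfolding fB by (simp add: B_def emeasure_ball)
  qed
  have "emeasure lebesgue (f ` U) = emeasure lebesgue (\<Union>i\<in>C. f ` B i)"
    unfolding fUsplit using N(2) C(1)
    by (intro emeasure_Un_null_set sets.countable_UN') (auto simp: fB)
  also have "\<dots> = (\<integral>\<^sup>+i. emeasure lebesgue (f ` B i) \<partial>count_space C)"
    by (intro emeasure_UN_countable disj' C(1)) (auto simp: fB)
  also have "\<dots> = (\<integral>\<^sup>+i. emeasure lebesgue (B i) \<partial>count_space C)"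
    by (intro nn_integral_cong) (auto simp: eqB)
  also have "\<dots> = emeasure lebesgue (\<Union>i\<in>C. B i)"
    by (intro emeasure_UN_countable[symmetric] disj C(1)) (auto simp: B_def)
  also have "\<dots> = emeasure lebesgue ((\<Union>i\<in>C. B i) \<union> N)"
    using N(1) C(1) by (intro emeasure_Un_null_set[symmetric] sets.countable_UN') (auto simp: B_def)
  finally show ?thesis
    by (simp flip: Usplit)
qed

text \<open>A linear map that preserves the volume of boxes preserves all volumes, and a box differs from
its interior by a null set only.\<close>

lemma measure_isometric_image:
  fixes f :: "'a::euclidean_space \<Rightarrow> 'a"
  assumes f: "orthogonal_transformation f" and S: "S \<in> lmeasurable"
  shows "measure lebesgue (f ` S) = measure lebesgue S"
proof -
  have lin: "linear f"
    by (simp add: f orthogonal_transformation_linear)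
  have "measure lebesgue (f ` cbox a b) = 1 * measure lebesgue (cbox a b)" for a b
  proof -
    have neg: "negligible (cbox a b - box a b)"
      using negligible_frontier_interval by auto
    have "f ` cbox a b = f ` box a b \<union> f ` (cbox a b - box a b)"
      using box_subset_cbox by blast
    moreover have "f ` (cbox a b - box a b) \<in> null_sets lebesgue"
      using negligible_differentiable_image_negligible[OF _ neg linear_imp_differentiable_on[OF lin]] by (simp add: negligible_iff_null_sets)
    moreover have "f ` box a b \<in> sets lebesgue"
      using f open_surjective_linear_image[OF open_box lin] orthogonal_transformation_surj[OF f]
      by (metis borel_open sets_completionI_sets sets_lborel)
    ultimately have "emeasure lebesgue (f ` cbox a b) = emeasure lebesgue (f ` box a b)"
      by (simp add: emeasure_Un_null_set)
    also have "\<dots> = emeasure lebesgue (box a b)"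
      by (rule emeasure_isometric_image_open[OF f open_box])
    finally show ?thesis
      by (simp add: measure_def emeasure_lborel_box_eq emeasure_lborel_cbox_eq)
  qed
  from measure_linear_sufficient[OF lin S this] show ?thesis
    by simp
qed

text \<open>The basis is chosen greedily: let \<open>x\<close> maximise \<open>norm (A x)\<close> over the unit vectors of \<open>S\<close>. If \<open>y\<close>
in \<open>S\<close> is orthogonal to \<open>x\<close>, then \<open>A y\<close> is orthogonal to \<open>A x\<close>, since otherwise a slight tilt of \<open>x\<close>
towards \<open>y\<close> or away from it would increase \<open>norm (A x) / norm x\<close>. Hence the orthogonal complement of
\<open>x\<close> in \<open>S\<close> can be treated by induction.\<close>

lemma orthonormal_basis_with_orthogonal_images:
  fixes A :: "'a::euclidean_space \<Rightarrow> 'b::real_inner"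
  assumes A: "bounded_linear A" and "subspace S"
  shows "\<exists>B\<subseteq>S. finite B \<and> card B = dim S \<and> (\<forall>x\<in>B. norm x = 1) \<and>
           pairwise orthogonal B \<and> pairwise (\<lambda>x y. orthogonal (A x) (A y)) B"
  using \<open>subspace S\<close>
proof (induction "dim S" arbitrary: S)
  case 0
  then show ?case by (intro exI[of _ "{}"]) auto
next
  case (Suc n)
  interpret A: bounded_linear A by (rule A)
  have "S \<noteq> {0}"
    using Suc.hyps(2) by force
  with subspace_0[OF Suc.prems] obtain z where z: "z \<in> S" "z \<noteq> 0"
    by blast
  have "compact (sphere 0 1 \<inter> S)"
    using Suc.prems by (intro compact_Int_closed closed_subspace) auto
  moreover have "z /\<^sub>R norm z \<in> sphere 0 1 \<inter> S"
    using z Suc.prems by (simp add: subspace_scale)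
  moreover have "continuous_on (sphere 0 1 \<inter> S) (\<lambda>x. norm (A x))"
    by (intro continuous_intros A.continuous_on)
  ultimately obtain x where x: "x \<in> S" "norm x = 1"
      and xmax: "\<And>y. y \<in> S \<Longrightarrow> norm y = 1 \<Longrightarrow> norm (A y) \<le> norm (A x)"
    using continuous_attains_sup[of "sphere 0 1 \<inter> S" "\<lambda>x. norm (A x)"] by force
  have homog: "norm (A y) \<le> norm (A x) * norm y" if "y \<in> S" for y
  proof (cases "y = 0")
    case False
    have "norm (A (y /\<^sub>R norm y)) \<le> norm (A x)"
      using that False Suc.prems by (intro xmax) (auto simp: subspace_scale)
    with False show ?thesis
      by (simp add: A.scaleR field_simps)
  qed (simp add: A.zero)
  have orth: "A x \<bullet> A y = 0" if y: "y \<in> S" "x \<bullet> y = 0" for y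
  proof -
    define p q where "p = A x \<bullet> A y" and "q = (norm (A x))\<^sup>2 * (norm y)\<^sup>2"
    \<comment> \<open>The first-order gain of the tilt by \<open>t\<close> is \<open>2 * t * p\<close> and the loss is at most \<open>t\<^sup>2 * q\<close>; a small
      multiple of \<open>p\<close> makes the gain win unless \<open>p = 0\<close>.\<close>
    define t where "t = p / (q + 1)"
    have q: "0 \<le> q" by (simp add: q_def)
    have norm_xy: "(norm (x + t *\<^sub>R y))\<^sup>2 = 1 + t\<^sup>2 * (norm y)\<^sup>2"
      using y x by (simp add: power2_norm_eq_inner inner_add_left inner_add_right
          inner_commute norm_eq_1) (simp add: power2_eq_square)
    have "x + t *\<^sub>R y \<in> S"
      using x y Suc.prems by (simp add: subspace_add subspace_scale)
    then have "(norm (A (x + t *\<^sub>R y)))\<^sup>2 \<le> (norm (A x) * norm (x + t *\<^sub>R y))\<^sup>2"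
      by (intro power_mono homog) auto
    also have "(norm (A (x + t *\<^sub>R y)))\<^sup>2 = (norm (A x))\<^sup>2 + 2 * t * p + t\<^sup>2 * (norm (A y))\<^sup>2"
      by (simp add: A.add A.scaleR power2_norm_eq_inner inner_add_left inner_add_right
          inner_commute p_def) (simp add: power2_eq_square algebra_simps)
    also have "(norm (A x) * norm (x + t *\<^sub>R y))\<^sup>2 = (norm (A x))\<^sup>2 * (1 + t\<^sup>2 * (norm y)\<^sup>2)"
      by (simp add: power_mult_distrib norm_xy)
    finally have "2 * t * p \<le> t\<^sup>2 * q"
      using mult_nonneg_nonneg[of "t\<^sup>2" "(norm (A y))\<^sup>2"] unfolding q_def
      by (simp add: algebra_simps del: zero_le_mult_iff mult_nonneg_nonneg)
    moreover have p_eq: "p = t * (q + 1)"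
      using q by (simp add: t_def)
    ultimately have "t\<^sup>2 * (q + 2) \<le> 0"
      by (simp add: power2_eq_square algebra_simps)
    then have "t = 0"
      using q by (auto simp: mult_le_0_iff)
    then show ?thesis
      using p_eq by (simp add: p_def)
  qed
  define S' where "S' = {y \<in> S. \<forall>u\<in>span {x}. orthogonal u y}"
  have S'_iff: "y \<in> S' \<longleftrightarrow> y \<in> S \<and> x \<bullet> y = 0" for y
    unfolding S'_def orthogonal_def span_singleton by auto
  have "subspace S'"
    using Suc.prems by (auto simp: subspace_def S'_iff inner_add_right)
  have "dim S' + dim (span {x}) = dim S"
    unfolding S'_def using x Suc.prems span_minimal[of "{x}" S]
    by (intro dim_subspace_orthogonal_to_vectors) auto
  moreover have "dim {x} = 1"
    using x by (subst dim_eq_card_independent) auto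
  ultimately have "n = dim S'"
    using Suc.hyps(2) by simp
  from Suc.hyps(1)[OF this \<open>subspace S'\<close>] obtain B where B: "B \<subseteq> S'" "finite B" "card B = dim S'"
      "\<forall>x\<in>B. norm x = 1" "pairwise orthogonal B" "pairwise (\<lambda>x y. orthogonal (A x) (A y)) B"
    by blast
  have "x \<notin> B"
    using B(1) x S'_iff by (auto simp: norm_eq_1)
  moreover have "y \<in> S" "orthogonal x y" "orthogonal y x" "orthogonal (A x) (A y)" "orthogonal (A y) (A x)"
    if "y \<in> B" for y
    using that B(1) orth[of y] by (auto simp: S'_iff orthogonal_def inner_commute)
  ultimately show ?case
    using B(2-) x Suc.hyps(2) \<open>n = dim S'\<close>
    by (intro exI[of _ "insert x B"]) (auto simp: pairwise_insert)
qed

definition diag :: "('n \<Rightarrow> real) \<Rightarrow> real ^ 'n ^ 'n" where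
  "diag d = (\<chi> i j. if i = j then d i else 0)"

lemma diag_vec: "diag d *v x = (\<chi> i. d i * x $ i)"
  by (simp add: diag_def matrix_vector_mult_def vec_eq_iff if_distrib[of "\<lambda>a. a * _"] cong: if_cong)

lemma det_diag: "det (diag d) = (\<Prod>i\<in>UNIV. d i)"
  by (subst det_diagonal) (auto simp: diag_def)

text \<open>The columns of \<open>U\<close> are an orthonormal basis whose images under \<open>A\<close> are orthogonal; \<open>d\<close> holds the
lengths of these images and the columns of \<open>V\<close> their directions.\<close>

lemma singular_value_decomposition:
  fixes A :: "real ^ 'n ^ 'n"
  assumes "invertible A"
  obtains U V d where "orthogonal_matrix U" "orthogonal_matrix V" "\<And>i. 0 < d i"
    "A ** U = V ** diag d"
proof -
  have "bounded_linear ((*v) A)"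
    by (simp add: linear_linear)
  from orthonormal_basis_with_orthogonal_images[OF this, of UNIV]
  obtain B where B: "finite B" "card B = CARD('n)" "\<forall>x\<in>B. norm x = 1" "pairwise orthogonal B"
      "pairwise (\<lambda>x y. orthogonal (A *v x) (A *v y)) B"
    by (auto simp: dim_UNIV)
  then obtain u where u: "bij_betw u (UNIV :: 'n set) B"
    by (metis finite_class.finite_UNIV finite_same_card_bij)
  then have uB: "u i \<in> B" and u_inj: "i \<noteq> j \<Longrightarrow> u i \<noteq> u j" for i j
    by (auto simp: bij_betw_def inj_def)
  define d where "d i = norm (A *v u i)" for i
  have d: "0 < d i" for i
  proof -
    have "u i \<noteq> 0"
      using B(3) uB[of i] by auto
    then show ?thesis
      using assms by (auto simp: d_def invertible_eq_bij matrix_left_invertible_ker[symmetric] invertible_left_inverse)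
        (metis assms invertible_left_inverse matrix_left_invertible_ker)
  qed
  define U :: "real ^ 'n ^ 'n" where "U = (\<chi> i j. u j $ i)"
  define V :: "real ^ 'n ^ 'n" where "V = (\<chi> i j. (A *v u j) $ i / d j)"
  have colU: "column j U = u j" and colV: "column j V = (A *v u j) /\<^sub>R d j" for j
    by (simp_all add: U_def V_def column_def vec_eq_iff field_simps)
  show thesis
  proof
    show "orthogonal_matrix U"
      unfolding orthogonal_matrix_orthonormal_columns colU
      using B uB u_inj by (meson pairwiseD)
    show "orthogonal_matrix V"
      unfolding orthogonal_matrix_orthonormal_columns colV
      using B uB u_inj d
      by (auto simp: d_def[symmetric] orthogonal_clauses pairwise_def abs_of_pos less_imp_neq[THEN not_sym])
    show "0 < d i" for i by (rule d)
    show "A ** U = V ** diag d"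
      using d by (simp add: vec_eq_iff matrix_matrix_mult_def V_def U_def diag_def matrix_vector_mult_def
          if_distrib[of "\<lambda>a. _ * a"] less_imp_neq[THEN not_sym] cong: if_cong)
  qed
qed


section \<open>Ellipsoids and their volume\<close>

abbreviation affine_ball :: "real ^ 'n \<Rightarrow> real ^ 'n ^ 'n \<Rightarrow> (real ^ 'n) set" where
  "affine_ball c T \<equiv> (\<lambda>x. c + T *v x) ` cball 0 1"

text \<open>The matrix of an ellipsoid is determined only up to an orthogonal factor on the right. All
choices of convenient axes below use this freedom.\<close>

lemma affine_ball_orthogonal:
  fixes T Q :: "real ^ 'n ^ 'n"
  assumes "orthogonal_matrix Q"
  shows "affine_ball c (T ** Q) = affine_ball c T"
proof -
  have "orthogonal_transformation ((*v) Q)"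
    using assms by (simp add: orthogonal_transformation_matrix)
  then have "(*v) Q ` cball 0 1 = cball 0 1"
    by (simp add: image_orthogonal_transformation_cball)
  then have "(\<lambda>x. c + T *v x) ` cball 0 1 = (\<lambda>x. c + T *v x) ` (*v) Q ` cball 0 1"
    by simp
  then show ?thesis
    by (simp add: image_image matrix_vector_mul_assoc)
qed

lemma abs_det_mult_orthogonal:
  fixes T Q :: "real ^ 'n ^ 'n"
  assumes "orthogonal_matrix Q"
  shows "\<bar>det (T ** Q)\<bar> = \<bar>det T\<bar>"
  using det_orthogonal_matrix[OF assms] by (auto simp: det_mul abs_mult)

lemma measure_affine_ball:
  fixes T :: "real ^ 'n ^ 'n"
  assumes "invertible T"
  shows "measure lebesgue (affine_ball c T) =
    \<bar>det T\<bar> * measure lebesgue (cball (0 :: real ^ 'n) 1)"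
proof -
  obtain U V d where UV: "orthogonal_matrix U" "orthogonal_matrix V" "\<And>i. 0 < d i"
    and TU: "T ** U = V ** diag d"
    using singular_value_decomposition[OF assms] by metis
  let ?B = "cball (0 :: real ^ 'n) 1"
  have V: "orthogonal_transformation ((*v) V)"
    using UV by (simp add: orthogonal_transformation_matrix)
  have "(\<lambda>x. c + T *v x) ` ?B = (+) c ` ((*v) V ` (\<lambda>x. \<chi> i. d i * x $ i) ` ?B)"
    by (subst affine_ball_orthogonal[OF UV(1), symmetric])
       (simp add: TU image_image diag_vec flip: matrix_vector_mul_assoc)
  then have "measure lebesgue ((\<lambda>x. c + T *v x) ` ?B) = \<bar>prod d UNIV\<bar> * measure lebesgue ?B"
    by (simp add: measure_translation measure_isometric_image[OF V] measurable_stretch measure_stretch)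
  moreover have "\<bar>det T\<bar> = \<bar>prod d UNIV\<bar>"
    using abs_det_mult_orthogonal[OF UV(1), of T] det_orthogonal_matrix[OF UV(2)]
    by (auto simp: TU det_mul det_diag abs_mult)
  ultimately show ?thesis by simp
qed

text \<open>With the new matrices \<open>T1 ** V\<close> and \<open>T2 ** U\<close> of the same two ellipsoids, the second arises from
the first by stretching along the axes: this is the singular value decomposition of \<open>S ** T2\<close>,
where \<open>S\<close> is the inverse of \<open>T1\<close>.\<close>

lemma simultaneous_diagonalization:
  fixes T1 T2 :: "real ^ 'n ^ 'n"
  assumes "invertible T1" "invertible T2"
  obtains U V d where "orthogonal_matrix U" "orthogonal_matrix V" "\<And>i. 0 < d i"
    "T2 ** U = T1 ** V ** diag d"
proof -
  obtain S where S: "T1 ** S = mat 1" "S ** T1 = mat 1"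
    using assms(1) by (auto simp: invertible_def)
  then have "invertible (S ** T2)"
    using assms(2) by (intro invertible_mult) (auto simp: invertible_def)
  then obtain U V d where UV: "orthogonal_matrix U" "orthogonal_matrix V" "\<And>i. 0 < d i"
    and "S ** T2 ** U = V ** diag d"
    using singular_value_decomposition by metis
  then have "T1 ** (S ** T2 ** U) = T1 ** (V ** diag d)"
    by simp
  then have "T2 ** U = T1 ** V ** diag d"
    by (simp add: matrix_mul_assoc S)
  with UV that show thesis by blast
qed

lemma rotate_to_axis:
  fixes z :: "real ^ 'n"
  obtains Q where "orthogonal_matrix Q" "Q *v (norm z *\<^sub>R axis k 1) = z"
proof -
  have "\<exists>e. norm e = 1 \<and> norm z *\<^sub>R e = z"
  proof (cases "z = 0")
    case True
    then show ?thesis by (intro exI[of _ "axis k 1"]) simp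
  next
    case False
    then show ?thesis by (intro exI[of _ "z /\<^sub>R norm z"]) simp
  qed
  then obtain e where e: "norm e = 1" "norm z *\<^sub>R e = z" by blast
  obtain Q where "orthogonal_matrix Q" "Q *v axis k 1 = e"
    using orthogonal_matrix_exists_basis[OF e(1)] .
  with e that show thesis
    by (simp add: matrix_vector_mult_scaleR)
qed

text \<open>The equality case of the arithmetic-geometric mean inequality between \<open>1\<close> and \<open>d i\<close>, multiplied
over the axes. The deficit in each axis comes from the identity \<open>((1 + s) / 2)\<^sup>2 = s + ((1 - s) / 2)\<^sup>2\<close>.\<close>

lemma eq_1_if_prod_midpoints_le:
  fixes d :: "'n :: finite \<Rightarrow> real"
  assumes d: "\<And>i. 0 < d i" and le: "(\<Prod>i\<in>UNIV. (1 + d i) / 2)\<^sup>2 \<le> (\<Prod>i\<in>UNIV. d i)"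
  shows "d k = 1"
proof (rule ccontr)
  assume "d k \<noteq> 1"
  have diff: "((1 + d i) / 2)\<^sup>2 = d i + ((1 - d i) / 2)\<^sup>2" for i
    by (simp add: power2_eq_square field_simps)
  have "(\<Prod>i\<in>UNIV. d i) = d k * (\<Prod>i\<in>UNIV - {k}. d i)"
    by (simp add: prod.remove)
  also have "\<dots> < ((1 + d k) / 2)\<^sup>2 * (\<Prod>i\<in>UNIV - {k}. ((1 + d i) / 2)\<^sup>2)"
  proof (rule mult_less_le_imp_less)
    show "d k < ((1 + d k) / 2)\<^sup>2"
      unfolding diff using \<open>d k \<noteq> 1\<close> by simp
    show "(\<Prod>i\<in>UNIV - {k}. d i) \<le> (\<Prod>i\<in>UNIV - {k}. ((1 + d i) / 2)\<^sup>2)"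
      unfolding diff using d by (intro prod_mono) (simp add: less_imp_le)
    show "0 \<le> d k" "0 < (\<Prod>i\<in>UNIV - {k}. d i)"
      using d by (auto intro: prod_pos less_imp_le)
  qed
  also have "\<dots> = (\<Prod>i\<in>UNIV. ((1 + d i) / 2)\<^sup>2)"
    by (simp add: prod.remove[of UNIV k])
  finally show False
    using le by (simp add: prod_power_distrib)
qed

section \<open>Log-concave and upper semicontinuous functions\<close>

lemma log_concave_fun_nonneg:
  "log_concave_fun f \<Longrightarrow> 0 \<le> f x"
  by (auto simp: log_concave_fun_def exp_uminus_def)

text \<open>Lower bounds \<open>a\<close> and \<open>b\<close> that are positive force the exponents at \<open>x\<close> and \<open>y\<close> to be finite, so
that convexity becomes an inequality between reals.\<close>

lemma log_concave_fun_ge: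
  assumes f: "log_concave_fun f" and a: "0 < a" "a \<le> f x" and b: "0 < b" "b \<le> f y"
    and u: "0 \<le> u" "u \<le> 1"
  shows "exp ((1 - u) * ln a + u * ln b) \<le> f ((1 - u) *\<^sub>R x + u *\<^sub>R y)"
proof -
  obtain v where v: "ereal_convex v" and fv: "\<And>x. f x = exp_uminus (v x)"
    using f by (auto simp: log_concave_fun_def)
  \<comment> \<open>A positive value excludes the exponent \<open>\<infinity>\<close>, and convexity excludes \<open>- \<infinity>\<close>.\<close>
  have finite: "\<exists>r. v w = ereal r \<and> f w = exp (- r)" if "0 < f w" for w
    using that v fv[of w] by (cases "v w") (auto simp: exp_uminus_def ereal_convex_def)
  obtain r where r: "v x = ereal r" "f x = exp (- r)"
    using finite[of x] a by auto
  obtain s where s: "v y = ereal s" "f y = exp (- s)"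
    using finite[of y] b by auto
  define z where "z = (1 - u) *\<^sub>R x + u *\<^sub>R y"
  have "v z \<le> ereal ((1 - u) * r + u * s)" and "v z \<noteq> - \<infinity>"
    using v u r s by (auto simp: ereal_convex_def z_def)
      (metis plus_ereal.simps(1) times_ereal.simps(1))
  then obtain q where q: "v z = ereal q" "q \<le> (1 - u) * r + u * s"
    by (cases "v z") auto
  have "ln a \<le> - r" "ln b \<le> - s"
    using a b r s by (metis ln_exp ln_le_cancel_iff exp_gt_zero)+
  then have "(1 - u) * ln a + u * ln b \<le> (1 - u) * (- r) + u * (- s)"
    using u by (intro add_mono mult_left_mono) auto
  also have "\<dots> \<le> - q"
    using q by simp
  finally show ?thesis
    using fv[of z] q by (simp add: exp_uminus_def z_def)
qed

lemma log_concave_fun_superlevel: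
  assumes "log_concave_fun f" "0 < a" "a \<le> f x" "a \<le> f y" "0 \<le> u" "u \<le> 1"
  shows "a \<le> f ((1 - u) *\<^sub>R x + u *\<^sub>R y)"
  using log_concave_fun_ge[of f a x a y u] assms by (simp add: algebra_simps)

lemma log_concave_fun_midpoint:
  assumes "log_concave_fun f" "0 < a" "a \<le> f x" "0 < b" "b \<le> f y"
  shows "sqrt (a * b) \<le> f (midpoint x y)"
proof -
  have "exp ((1 - 1/2) * ln a + 1/2 * ln b) = exp (ln (sqrt (a * b)))"
    using assms by (simp add: ln_sqrt ln_mult field_simps)
  moreover have "midpoint x y = (1 - 1/2) *\<^sub>R x + (1/2) *\<^sub>R y"
    by (simp add: midpoint_def algebra_simps)
  ultimately show ?thesis
    using log_concave_fun_ge[of f a x b y "1/2"] assms by simp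
qed

lemma convex_superlevel:
  assumes "log_concave_fun f" "0 < a"
  shows "convex {x. a \<le> f x}"
  unfolding convex_alt using log_concave_fun_superlevel[OF assms] by auto

lemma closed_hypograph:
  assumes "upper_semicontinuous f"
  shows "closed {(x, a). a \<le> f x}"
proof -
  have "open {(x, a). f x < a}"
  proof (rule open_prod_intro)
    fix p assume "p \<in> {(x, a). f x < a}"
    then obtain x a where p: "p = (x, a)" "f x < a" by auto
    then obtain s where s: "f x < s" "s < a" using dense by blast
    then have "\<forall>\<^sub>F y in at x. f y < s"
      using assms by (simp add: upper_semicontinuous_def)
    then obtain U where "open U" "x \<in> U" "\<forall>y\<in>U. y \<noteq> x \<longrightarrow> f y < s"
      by (auto simp: eventually_at_topological)
    then have "f y < s" if "y \<in> U" for y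
      using that s by (cases "y = x") auto
    with p s \<open>open U\<close> \<open>x \<in> U\<close> show "\<exists>A B. open A \<and> open B \<and> p \<in> A \<times> B \<and> A \<times> B \<subseteq> {(x, a). f x < a}"
      by (intro exI[of _ U] exI[of _ "{s<..}"]) (auto intro: less_trans)
  qed
  moreover have "- {(x, a). a \<le> f x} = {(x, a). f x < a}"
    by auto
  ultimately show ?thesis
    by (simp add: closed_def)
qed

text \<open>Used for matrices of ellipsoids that lie in one common ball: the columns are then differences
of points of that ball.\<close>

lemma bounded_matrix_of_bounded_columns:
  fixes \<T> :: "(real ^ 'n ^ 'm) set"
  assumes "\<And>T j. T \<in> \<T> \<Longrightarrow> norm (T *v axis j 1) \<le> R"
  shows "bounded \<T>"
proof (rule boundedI)
  fix T assume "T \<in> \<T>"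
  have entry: "\<bar>T $ i $ j\<bar> \<le> R" for i j
  proof -
    have "T $ i $ j = (T *v axis j 1) $ i"
      by (simp add: column_def matrix_vector_mult_basis)
    also have "\<bar>\<dots>\<bar> \<le> norm (T *v axis j 1)"
      by (rule component_le_norm_cart)
    finally show ?thesis
      using assms[OF \<open>T \<in> \<T>\<close>, of j] by simp
  qed
  have "norm T \<le> (\<Sum>i\<in>UNIV. norm (T $ i))"
    unfolding norm_vec_def by (rule L2_set_le_sum) simp
  also have "\<dots> \<le> (\<Sum>i\<in>(UNIV::'m set). \<Sum>j\<in>(UNIV::'n set). R)"
    by (intro sum_mono order_trans[OF norm_le_l1_cart] entry)
  finally show "norm T \<le> (\<Sum>i\<in>(UNIV::'m set). \<Sum>j\<in>(UNIV::'n set). R)" .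
qed


section \<open>Ellipsoids inscribed in the graph of a log-concave function\<close>

locale integrable_log_concave =
  fixes f :: "real ^ 'n \<Rightarrow> real"
  assumes log_concave: "log_concave_fun f"
    and integrable: "integrable lebesgue f"
    and usc: "upper_semicontinuous f"
    and integral_pos: "0 < (\<integral>x. f x \<partial>lebesgue)"
begin

text \<open>The parameters \<open>(c, T, a)\<close> of an ellipsoidal function below \<open>f\<close>. The content of that function is
\<open>a * (\<bar>det T\<bar> * \<kappa>)\<close>, so maximising the content means maximising \<open>a * \<bar>det T\<bar>\<close>.\<close>

definition inscribed :: "real ^ 'n \<Rightarrow> real ^ 'n ^ 'n \<Rightarrow> real \<Rightarrow> bool" where
  "inscribed c T a \<longleftrightarrow> 0 < a \<and> invertible T \<and> (\<forall>x\<in>cball 0 1. a \<le> f (c + T *v x))"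

definition \<kappa> :: real where
  "\<kappa> = measure lebesgue (cball (0 :: real ^ 'n) 1)"

lemma kappa_pos: "0 < \<kappa>"
  by (simp add: \<kappa>_def content_cball_pos)

lemma f_nonneg: "0 \<le> f x"
  by (rule log_concave_fun_nonneg[OF log_concave])

lemma integrable_min: "0 \<le> b \<Longrightarrow> integrable lebesgue (\<lambda>x. min (f x) b)"
  using integrable by (rule Bochner_Integration.integrable_bound)
    (use integrable f_nonneg in \<open>auto simp: abs_if min_def\<close>)

lemma inscribed_det_nonzero: "inscribed c T a \<Longrightarrow> 0 < \<bar>det T\<bar>"
  by (simp add: inscribed_def invertible_det_nz)

text \<open>An ellipsoidal function of height at most \<open>b\<close> lies below \<open>f\<close> truncated at \<open>b\<close>. The truncated
integral tends to zero with \<open>b\<close>, so this bounds from below the height of ellipsoidal functions of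
large content.\<close>

lemma inscribed_content_le_min:
  assumes E: "inscribed c T a" and b: "a \<le> b"
  shows "a * (\<bar>det T\<bar> * \<kappa>) \<le> (\<integral>x. min (f x) b \<partial>lebesgue)"
proof -
  define E where "E = (\<lambda>x. c + T *v x) ` cball 0 1"
  have "compact E"
    unfolding E_def by (intro compact_continuous_image continuous_intros compact_cball
        matrix_vector_mult_linear_continuous_on)
  then have Em: "E \<in> lmeasurable"
    by (rule lmeasurable_compact)
  then have int: "integrable lebesgue (\<lambda>x. a * indicator E x)"
    by (intro integrable_mult_right) (auto simp: fmeasurable_def)
  have "a * (\<bar>det T\<bar> * \<kappa>) = (\<integral>x. a * indicator E x \<partial>lebesgue)"
    using E measure_affine_ball[of T c] by (simp add: inscribed_def E_def \<kappa>_def)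
  also have "\<dots> \<le> (\<integral>x. min (f x) b \<partial>lebesgue)"
    using E b int f_nonneg
    by (intro integral_mono integrable_min) (auto simp: inscribed_def E_def indicator_def)
  finally show ?thesis .
qed

lemma inscribed_content_le:
  assumes "inscribed c T a"
  shows "a * (\<bar>det T\<bar> * \<kappa>) \<le> (\<integral>x. f x \<partial>lebesgue)"
proof -
  have "0 < a" using assms by (simp add: inscribed_def)
  then have "(\<integral>x. min (f x) a \<partial>lebesgue) \<le> (\<integral>x. f x \<partial>lebesgue)"
    using integrable by (intro integral_mono integrable_min) auto
  with inscribed_content_le_min[OF assms order_refl] show ?thesis by simp
qed

lemma integral_min_small:
  assumes "0 < e"
  obtains b where "0 < b" "(\<integral>x. min (f x) b \<partial>lebesgue) < e"
proof -
  have "(\<lambda>n. \<integral>x. min (f x) (inverse (real (Suc n))) \<partial>lebesgue) \<longlonglongrightarrow> (\<integral>x. 0 \<partial>(lebesgue :: (real ^ 'n) measure))"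
  proof (rule integral_dominated_convergence[where w = f])
    show "AE x in lebesgue. (\<lambda>n. min (f x) (inverse (real (Suc n)))) \<longlonglongrightarrow> 0"
    proof (rule AE_I2)
      fix x
      have "(\<lambda>n. min (f x) (inverse (real (Suc n)))) \<longlonglongrightarrow> min (f x) 0"
        by (intro tendsto_min tendsto_const LIMSEQ_inverse_real_of_nat)
      then show "(\<lambda>n. min (f x) (inverse (real (Suc n)))) \<longlonglongrightarrow> 0"
        using f_nonneg[of x] by (simp add: min_absorb2)
    qed
  qed (use integrable integrable_min f_nonneg in \<open>auto simp: abs_if min_def\<close>)
  then have "\<forall>\<^sub>F n in sequentially. (\<integral>x. min (f x) (inverse (real (Suc n))) \<partial>lebesgue) < e"
    using assms by (auto dest!: order_tendstoD(2))
  then obtain n where "(\<integral>x. min (f x) (inverse (real (Suc n))) \<partial>lebesgue) < e"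
    by (auto simp: eventually_sequentially)
  then show thesis
    by (intro that[of "inverse (real (Suc n))"]) auto
qed

text \<open>Since the integral is positive, some superlevel set of \<open>f\<close> is not a null set; being convex, it has
interior points and contains a ball.\<close>

lemma inscribed_exists: "\<exists>c T a. inscribed c T a"
proof -
  define L where "L n = {x. inverse (real (Suc n)) \<le> f x}" for n
  have "\<exists>n. \<not> negligible (L n)"
  proof (rule ccontr)
    assume "\<nexists>n. \<not> negligible (L n)"
    then have "negligible (\<Union>n. L n)"
      by (intro negligible_countable_Union) auto
    then have "AE x in lebesgue. x \<notin> (\<Union>n. L n)"
      by (intro AE_not_in) (simp add: negligible_iff_null_sets)
    moreover have "f x = 0" if "x \<notin> (\<Union>n. L n)" for x
    proof (rule ccontr)
      assume "f x \<noteq> 0"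
      with f_nonneg[of x] have "0 < f x" by simp
      then obtain n where "inverse (real (Suc n)) < f x"
        using reals_Archimedean by blast
      with that show False
        by (auto simp: L_def intro: less_imp_le)
    qed
    ultimately have "(\<integral>x. f x \<partial>lebesgue) = (\<integral>x. 0 \<partial>(lebesgue :: (real ^ 'n) measure))"
      using integrable by (intro integral_cong_AE) (auto intro: borel_measurable_integrable)
    with integral_pos show False by simp
  qed
  then obtain n where "\<not> negligible (L n)" ..
  moreover have "convex (L n)"
    unfolding L_def by (intro convex_superlevel log_concave) simp
  ultimately obtain c where "c \<in> interior (L n)"
    using negligible_convex_interior by blast
  then obtain e where e: "0 < e" "cball c e \<subseteq> L n"
    by (meson mem_interior_cball)
  have diag_eq: "diag (\<lambda>_. e) *v x = e *\<^sub>R x" for x :: "real ^ 'n"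
    by (simp add: diag_vec vec_eq_iff)
  have "inscribed c (diag (\<lambda>_. e)) (inverse (real (Suc n)))"
    unfolding inscribed_def
  proof (intro conjI ballI)
    show "invertible (diag (\<lambda>_. e) :: real ^ 'n ^ 'n)"
      using e by (simp add: invertible_det_nz det_diag)
    fix x :: "real ^ 'n" assume "x \<in> cball 0 1"
    then have "c + e *\<^sub>R x \<in> cball c e"
      using e by (simp add: dist_norm)
    with e show "inverse (real (Suc n)) \<le> f (c + diag (\<lambda>_. e) *v x)"
      by (auto simp: diag_eq L_def)
  qed simp
  then show ?thesis by blast
qed

text \<open>On the half sum of two sets, log-concavity gives the geometric mean of the two heights. The
entries of \<open>d\<close> may vanish, so that the second set may also be a single point.\<close>

lemma midpoint_inscribed:
  assumes E: "inscribed c T a" and b: "0 < b" "\<And>x. x \<in> cball 0 1 \<Longrightarrow> b \<le> f (c' + (T ** diag d) *v x)"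
    and d: "\<And>i. 0 \<le> d i"
  shows "inscribed (midpoint c c') (T ** diag (\<lambda>i. (1 + d i) / 2)) (sqrt (a * b))"
  unfolding inscribed_def
proof (intro conjI ballI)
  show "0 < sqrt (a * b)"
    using E b by (simp add: inscribed_def)
  have "(1 + d i) / 2 \<noteq> 0" for i
    using d[of i] by simp
  then show "invertible (T ** diag (\<lambda>i. (1 + d i) / 2))"
    using E by (simp add: inscribed_def invertible_det_nz det_mul det_diag)
  fix x :: "real ^ 'n" assume x: "x \<in> cball 0 1"
  have "diag (\<lambda>i. (1 + d i) / 2) *v x = midpoint x (diag d *v x)"
    by (simp add: diag_vec vec_eq_iff midpoint_def algebra_simps add_divide_distrib)
  then have "midpoint c c' + (T ** diag (\<lambda>i. (1 + d i) / 2)) *v x =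
      midpoint (c + T *v x) (c' + (T ** diag d) *v x)"
    by (simp add: midpoint_def algebra_simps matrix_vector_mult_scaleR vec.add vec.scale
        flip: matrix_vector_mul_assoc)
  then show "sqrt (a * b) \<le> f (midpoint c c' + (T ** diag (\<lambda>i. (1 + d i) / 2)) *v x)"
    using log_concave_fun_midpoint[OF log_concave] E b x by (simp add: inscribed_def)
qed

text \<open>A very large value at one point \<open>y\<close> would, by averaging a fixed inscribed ellipsoid with \<open>y\<close>, give
an ellipsoid half the size at a very large height, whose content would exceed the integral of \<open>f\<close>.\<close>

lemma bdd_above_range: "bdd_above (range f)"
proof -
  obtain c T a where E: "inscribed c T a"
    using inscribed_exists by blast
  then have a: "0 < a" by (simp add: inscribed_def)
  \<comment> \<open>The point \<open>y\<close> is the degenerate ellipsoid with \<open>d = 0\<close>; the factor \<open>(1 + 0) / 2\<close> is kept in the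
  form in which \<open>midpoint_inscribed\<close> produces it.\<close>
  define D where "D = \<bar>det (T ** diag (\<lambda>i. (1 + 0) / 2))\<bar> * \<kappa>"
  define I where "I = (\<integral>x. f x \<partial>lebesgue)"
  have D: "0 < D"
    using inscribed_det_nonzero[OF E] kappa_pos by (simp add: D_def det_mul det_diag)
  have "f y \<le> (I / D)\<^sup>2 / a" for y
  proof (cases "f y = 0")
    case False
    then have fy: "0 < f y" using f_nonneg[of y] by simp
    have "diag (\<lambda>_. 0) *v x = (0 :: real ^ 'n)" for x
      by (simp add: diag_vec vec_eq_iff)
    then have "inscribed (midpoint c y) (T ** diag (\<lambda>i. (1 + 0) / 2)) (sqrt (a * f y))"
      using E fy by (intro midpoint_inscribed) (auto simp flip: matrix_vector_mul_assoc)
    from inscribed_content_le[OF this] have "sqrt (a * f y) \<le> I / D"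
      using D by (simp add: D_def I_def field_simps)
    then have "(sqrt (a * f y))\<^sup>2 \<le> (I / D)\<^sup>2"
      using a fy by (intro power_mono) auto
    then show ?thesis
      using a fy by (simp add: pos_le_divide_eq mult.commute)
  qed (use a in simp)
  then show ?thesis
    by (auto simp: bdd_above_def)
qed

lemma inscribed_orthogonal:
  assumes "inscribed c T a" "orthogonal_matrix Q"
  shows "inscribed c (T ** Q) a"
proof -
  have "f x \<ge> a" if "x \<in> affine_ball c (T ** Q)" for x
    using that assms unfolding affine_ball_orthogonal[OF assms(2)] by (auto simp: inscribed_def)
  moreover have "invertible (T ** Q)"
    using assms abs_det_mult_orthogonal[OF assms(2), of T]
    by (auto simp: inscribed_def invertible_det_nz simp del: det_mul)
  ultimately show ?thesis
    using assms by (auto simp: inscribed_def)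
qed

text \<open>The convex hull of an ellipsoid and a point far away contains an ellipsoid whose volume grows
linearly with the distance. In coordinates in which the ellipsoid is the unit ball and the point is
\<open>z\<close>, shrink the ball by the factor \<open>1/2\<close>, centre it at \<open>z / 4\<close> and stretch it in the direction of \<open>z\<close>.\<close>

lemma cone_inscribed:
  assumes E: "inscribed c T a" and b: "0 < b" "b \<le> f (c + T *v z)"
  obtains c' T' where "inscribed c' T' (min a b)"
    "\<bar>det T'\<bar> = \<bar>det T\<bar> * (1/2) ^ CARD('n) * (1 + norm z / 2)"
proof -
  define r where "r = norm z"
  \<comment> \<open>Any coordinate axis serves as the direction of stretching.\<close>
  obtain k :: 'n where True by simp
  obtain Q where Q: "orthogonal_matrix Q" "Q *v (r *\<^sub>R axis k 1) = z"
    using rotate_to_axis[of z k] unfolding r_def .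
  define S where "S = T ** Q"
  have S: "inscribed c S a" "\<bar>det S\<bar> = \<bar>det T\<bar>"
    unfolding S_def using inscribed_orthogonal[OF E Q(1)] abs_det_mult_orthogonal[OF Q(1)] by auto
  have z: "S *v (r *\<^sub>R axis k 1) = T *v z"
    by (simp only: S_def Q flip: matrix_vector_mul_assoc)
  have r: "0 \<le> r" by (simp add: r_def)
  define d where "d i = 1/2 * (if i = k then 1 + r / 2 else 1)" for i
  have d: "0 < d i" for i
    using r by (simp add: d_def)
  show thesis
  proof
    show "inscribed (c + S *v ((r / 4) *\<^sub>R axis k 1)) (S ** diag d) (min a b)"
      unfolding inscribed_def
    proof (intro conjI ballI)
      show "0 < min a b" using E b by (simp add: inscribed_def)
      show "invertible (S ** diag d)"
        using S d by (auto simp: inscribed_def invertible_det_nz det_mul det_diag less_imp_neq[THEN not_sym])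
      fix u :: "real ^ 'n" assume u: "u \<in> cball 0 1"
      \<comment> \<open>The weight of the apex: it is affine in \<open>u\<close>, and at most \<open>1/2\<close>, which leaves room for \<open>u / 2\<close>
        in the ball scaled by \<open>1 - t\<close>.\<close>
      define t where "t = (1 + u $ k) / 4"
      have "\<bar>u $ k\<bar> \<le> 1"
        using u component_le_norm_cart[of u k] by simp
      then have t: "0 \<le> t" "t \<le> 1/2"
        by (auto simp: t_def)
      define w where "w = u /\<^sub>R (2 * (1 - t))"
      have w: "(1 - t) *\<^sub>R w = u /\<^sub>R 2" "norm w \<le> 1"
        using u t by (auto simp: w_def field_simps)
      have "(r / 4) *\<^sub>R axis k 1 + diag d *v u = u /\<^sub>R 2 + t *\<^sub>R (r *\<^sub>R axis k 1)"
        by (simp add: vec_eq_iff diag_vec d_def axis_def t_def field_simps)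
      also have "\<dots> = (1 - t) *\<^sub>R w + t *\<^sub>R (r *\<^sub>R axis k 1)"
        by (simp only: w)
      finally have "S *v ((r / 4) *\<^sub>R axis k 1 + diag d *v u) = (1 - t) *\<^sub>R (S *v w) + t *\<^sub>R (T *v z)"
        by (simp only: vec.add matrix_vector_mult_scaleR[of S "1 - t"] matrix_vector_mult_scaleR[of S t] z)
      then have "c + S *v ((r / 4) *\<^sub>R axis k 1) + (S ** diag d) *v u =
          (1 - t) *\<^sub>R (c + S *v w) + t *\<^sub>R (c + T *v z)"
        by (simp add: vec.add algebra_simps flip: matrix_vector_mul_assoc)
      moreover have "a \<le> f (c + S *v w)"
        using S(1) w(2) by (simp add: inscribed_def)
      ultimately show "min a b \<le> f (c + S *v ((r / 4) *\<^sub>R axis k 1) + (S ** diag d) *v u)"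
        using log_concave_fun_superlevel[OF log_concave, of "min a b" "c + S *v w" "c + T *v z" t]
          E b t by (simp add: inscribed_def)
    qed
    have "prod d UNIV = (1/2) ^ CARD('n) * (1 + r / 2)"
      unfolding d_def prod.distrib by (simp add: prod.delta)
    then show "\<bar>det (S ** diag d)\<bar> = \<bar>det T\<bar> * (1/2) ^ CARD('n) * (1 + norm z / 2)"
      using r S(2) by (simp add: r_def det_mul det_diag abs_mult)
  qed
qed

text \<open>By \<open>cone_inscribed\<close>, superlevel points far away would lead to inscribed ellipsoids of
arbitrarily large content, all at one fixed height.\<close>

lemma bounded_superlevel:
  assumes b: "0 < b"
  shows "bounded {y. b \<le> f y}"
proof -
  obtain c T a where E: "inscribed c T a"
    using inscribed_exists by blast
  then have a: "0 < a" by (simp add: inscribed_def)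
  obtain S where S: "T ** S = mat 1"
    using E by (auto simp: inscribed_def invertible_def)
  define D where "D = min a b * (\<bar>det T\<bar> * (1/2) ^ CARD('n) * \<kappa>)"
  define I where "I = (\<integral>x. f x \<partial>lebesgue)"
  have D: "0 < D"
    using inscribed_det_nonzero[OF E] kappa_pos a b by (simp add: D_def)
  have bound: "norm z \<le> 2 * I / D" if z: "b \<le> f (c + T *v z)" for z
  proof -
    obtain c' T' where E': "inscribed c' T' (min a b)"
        and det: "\<bar>det T'\<bar> = \<bar>det T\<bar> * (1/2) ^ CARD('n) * (1 + norm z / 2)"
      using cone_inscribed[OF E b z] by blast
    have "min a b * (\<bar>det T'\<bar> * \<kappa>) = D * (1 + norm z / 2)"
      by (simp only: det D_def mult_ac)
    then have "D * (1 + norm z / 2) \<le> I"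
      using inscribed_content_le[OF E'] by (simp add: I_def)
    then have "D * norm z \<le> 2 * I"
      using D by (simp add: algebra_simps)
    then show ?thesis
      using D by (simp add: field_simps)
  qed
  have "{y. b \<le> f y} \<subseteq> (\<lambda>z. c + T *v z) ` cball 0 (2 * I / D)"
  proof
    fix y assume y: "y \<in> {y. b \<le> f y}"
    have y_eq: "y = c + T *v (S *v (y - c))"
      by (simp add: matrix_vector_mul_assoc S)
    with y have "norm (S *v (y - c)) \<le> 2 * I / D"
      by (intro bound) simp
    with y_eq show "y \<in> (\<lambda>z. c + T *v z) ` cball 0 (2 * I / D)"
      by (intro image_eqI[of _ _ "S *v (y - c)"]) auto
  qed
  moreover have "bounded ((\<lambda>z. c + T *v z) ` cball 0 (2 * I / D))"
    by (intro compact_imp_bounded compact_continuous_image continuous_intros compact_cball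
        matrix_vector_mult_linear_continuous_on)
  ultimately show ?thesis
    by (rule bounded_subset[rotated])
qed

text \<open>Let \<open>m\<close> be the value of some inscribed ellipsoid. Those with value at least \<open>m\<close> have height at
least some \<open>b > 0\<close>, hence lie in a bounded superlevel set. Therefore their parameters form part of a compact
set \<open>K\<close>, on which the value, a continuous function, attains its maximum. The set \<open>K\<close> admits singular
matrices; these have value \<open>0\<close> and are not maximal.\<close>

lemma maximal_inscribed_exists:
  "\<exists>c T a. inscribed c T a \<and> (\<forall>c' T' a'. inscribed c' T' a' \<longrightarrow> a' * \<bar>det T'\<bar> \<le> a * \<bar>det T\<bar>)"
proof -
  obtain c1 T1 a1 where E1: "inscribed c1 T1 a1"
    using inscribed_exists by blast
  define m where "m = a1 * \<bar>det T1\<bar>"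
  have m: "0 < m"
    using E1 inscribed_det_nonzero[OF E1] by (simp add: m_def inscribed_def)
  obtain b where b: "0 < b" "(\<integral>x. min (f x) b \<partial>lebesgue) < m * \<kappa>"
    using integral_min_small[of "m * \<kappa>"] m kappa_pos by auto
  have height: "b \<le> a" if "inscribed c T a" "m \<le> a * \<bar>det T\<bar>" for c T a
  proof (rule ccontr)
    assume "\<not> b \<le> a"
    then have "a * (\<bar>det T\<bar> * \<kappa>) \<le> (\<integral>x. min (f x) b \<partial>lebesgue)"
      by (intro inscribed_content_le_min[OF that(1)]) simp
    moreover have "m * \<kappa> \<le> a * \<bar>det T\<bar> * \<kappa>"
      using that(2) kappa_pos by (intro mult_right_mono) auto
    ultimately show False
      using b by (simp add: mult.assoc)
  qed
  define K :: "((real ^ 'n) \<times> (real ^ 'n ^ 'n) \<times> real) set"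
    where "K = {(c, T, a). b \<le> a \<and> (\<forall>x\<in>cball 0 1. a \<le> f (c + T *v x))}"
  obtain R where R: "\<And>y. b \<le> f y \<Longrightarrow> norm y \<le> R"
    using bounded_superlevel[OF b(1)] by (auto simp: bounded_iff)
  have "bounded K"
  proof -
    have K: "norm c \<le> R" "a \<in> {0..sup_norm f}" "norm (T *v axis j 1) \<le> 2 * R"
      if "(c, T, a) \<in> K" for c T a j
    proof -
      have ge: "b \<le> f (c + T *v x)" "a \<le> f (c + T *v x)" if "norm x \<le> 1" for x
        using that \<open>(c, T, a) \<in> K\<close> by (auto simp: K_def intro: order_trans)
      show c: "norm c \<le> R"
        using R ge(1)[of 0] by simp
      have "f c \<le> sup_norm f"
        unfolding sup_norm_def by (intro cSUP_upper bdd_above_range) simp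
      then show "a \<in> {0..sup_norm f}"
        using ge(2)[of 0] that b by (auto simp: K_def)
      have "norm (c + T *v axis j 1) \<le> R"
        by (intro R ge(1)) simp
      with c show "norm (T *v axis j 1) \<le> 2 * R"
        using norm_triangle_ineq4[of "c + T *v axis j 1" c] by simp
    qed
    let ?\<T> = "(fst \<circ> snd) ` K"
    have "bounded ?\<T>"
      by (rule bounded_matrix_of_bounded_columns[of _ "2 * R"]) (use K(3) in auto)
    then have "bounded (cball 0 R \<times> ?\<T> \<times> {0..sup_norm f})"
      by (intro bounded_Times bounded_cball bounded_closed_interval)
    moreover have "K \<subseteq> cball 0 R \<times> ?\<T> \<times> {0..sup_norm f}"
      using K by (force simp: image_iff)
    ultimately show ?thesis
      by (rule bounded_subset)
  qed
  moreover have "closed K"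
  proof -
    have "closed {p :: (real ^ 'n) \<times> (real ^ 'n ^ 'n) \<times> real. b \<le> snd (snd p)}"
      by (intro closed_Collect_le continuous_intros)
    moreover have "closed ((\<lambda>p :: (real ^ 'n) \<times> (real ^ 'n ^ 'n) \<times> real.
        (fst p + fst (snd p) *v x, snd (snd p))) -` {(x, a). a \<le> f x})" for x
      unfolding matrix_vector_mult_def
      by (intro closed_vimage closed_hypograph usc continuous_intros)
    moreover have "K = {p. b \<le> snd (snd p)} \<inter>
        (\<Inter>x\<in>cball 0 1. (\<lambda>p. (fst p + fst (snd p) *v x, snd (snd p))) -` {(x, a). a \<le> f x})"
      by (auto simp: K_def)
    ultimately show ?thesis
      by (auto intro!: closed_Int closed_INT)
  qed
  ultimately have "compact K"
    by (simp add: compact_eq_bounded_closed)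
  moreover have "(c1, T1, a1) \<in> K"
    using E1 height[OF E1] by (simp add: K_def m_def inscribed_def)
  moreover have "continuous_on K (\<lambda>p. snd (snd p) * \<bar>det (fst (snd p))\<bar>)"
    unfolding det_def by (intro continuous_intros)
  ultimately obtain p where p: "p \<in> K"
      and pmax: "\<And>q. q \<in> K \<Longrightarrow> snd (snd q) * \<bar>det (fst (snd q))\<bar> \<le> snd (snd p) * \<bar>det (fst (snd p))\<bar>"
    using continuous_attains_sup[of K "\<lambda>p. snd (snd p) * \<bar>det (fst (snd p))\<bar>"] by blast
  obtain c T a where p_eq: "p = (c, T, a)" by (cases p)
  have mle: "m \<le> a * \<bar>det T\<bar>"
    using pmax[OF \<open>(c1, T1, a1) \<in> K\<close>] by (simp add: p_eq m_def)
  then have "inscribed c T a"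
    using p b m by (auto simp: p_eq K_def inscribed_def invertible_det_nz)
  moreover have "a' * \<bar>det T'\<bar> \<le> a * \<bar>det T\<bar>" if E': "inscribed c' T' a'" for c' T' a'
  proof (cases "m \<le> a' * \<bar>det T'\<bar>")
    case True
    then have "(c', T', a') \<in> K"
      using E' height[OF E'] by (auto simp: K_def inscribed_def)
    from pmax[OF this] show ?thesis by (simp add: p_eq)
  qed (use mle in simp)
  ultimately show ?thesis by blast
qed

text \<open>The convex hull of two distinct translates of an ellipsoid contains the ellipsoid centred halfway
and stretched in the direction of the translation.\<close>

lemma capsule_inscribed:
  assumes E: "inscribed c T a" and E': "inscribed c' T a" and "c \<noteq> c'"
  obtains T' where "inscribed (midpoint c c') T' a" "\<bar>det T\<bar> < \<bar>det T'\<bar>"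
proof -
  obtain R where R: "T ** R = mat 1"
    using E by (auto simp: inscribed_def invertible_def)
  define z where "z = R *v (c' - c)"
  have Tz: "T *v z = c' - c"
    by (simp add: z_def matrix_vector_mul_assoc R)
  define r where "r = norm z"
  have r: "0 < r"
    using Tz \<open>c \<noteq> c'\<close> by (auto simp: r_def)
  \<comment> \<open>Any coordinate axis serves as the direction of stretching.\<close>
  obtain k :: 'n where True by simp
  obtain Q where Q: "orthogonal_matrix Q" "Q *v (r *\<^sub>R axis k 1) = z"
    using rotate_to_axis[of z k] unfolding r_def .
  define S where "S = T ** Q"
  have S: "inscribed c S a" "inscribed c' S a" "\<bar>det S\<bar> = \<bar>det T\<bar>"
    unfolding S_def using inscribed_orthogonal[OF _ Q(1)] E E' abs_det_mult_orthogonal[OF Q(1)] by auto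
  have z: "S *v (r *\<^sub>R axis k 1) = c' - c"
    by (simp only: S_def Q Tz flip: matrix_vector_mul_assoc)
  define d where "d i = (if i = k then 1 + r / 2 else 1)" for i
  have d: "0 < d i" for i
    using r by (simp add: d_def)
  show thesis
  proof
    show "inscribed (midpoint c c') (S ** diag d) a"
      unfolding inscribed_def
    proof (intro conjI ballI)
      show "0 < a" using E by (simp add: inscribed_def)
      show "invertible (S ** diag d)"
        using S d by (auto simp: inscribed_def invertible_det_nz det_mul det_diag less_imp_neq[THEN not_sym])
      fix u :: "real ^ 'n" assume u: "u \<in> cball 0 1"
      define t where "t = (1 + u $ k) / 2"
      have "\<bar>u $ k\<bar> \<le> 1"
        using u component_le_norm_cart[of u k] by simp
      then have t: "0 \<le> t" "t \<le> 1"
        by (auto simp: t_def)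
      have "diag d *v u = u + (t - 1/2) *\<^sub>R (r *\<^sub>R axis k 1)"
        by (simp add: vec_eq_iff diag_vec d_def axis_def t_def field_simps)
      then have Su: "(S ** diag d) *v u = S *v u + (t - 1/2) *\<^sub>R (c' - c)"
        by (simp only: vec.add matrix_vector_mult_scaleR[of S "t - 1/2"] z flip: matrix_vector_mul_assoc)
      have "midpoint c c' + (S ** diag d) *v u = (1 - t) *\<^sub>R (c + S *v u) + t *\<^sub>R (c' + S *v u)"
        by (simp add: Su vec_eq_iff midpoint_def field_simps)
      moreover have "a \<le> f (c + S *v u)" "a \<le> f (c' + S *v u)"
        using S u by (auto simp: inscribed_def)
      ultimately show "a \<le> f (midpoint c c' + (S ** diag d) *v u)"
        using log_concave_fun_superlevel[OF log_concave] E t by (simp add: inscribed_def)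
    qed
    have "prod d UNIV = 1 + r / 2"
      unfolding d_def by (simp add: prod.delta)
    then have "\<bar>det (S ** diag d)\<bar> = \<bar>det T\<bar> * (1 + r / 2)"
      using r S(3) by (simp add: det_mul det_diag abs_mult)
    then show "\<bar>det T\<bar> < \<bar>det (S ** diag d)\<bar>"
      using r inscribed_det_nonzero[OF E] by simp
  qed
qed

text \<open>In coordinates in which both ellipsoids are coaxial, the average of the two has at least the
common value, and a larger one unless all axis ratios \<open>d i\<close> are \<open>1\<close>. Then the heights agree too and the
ellipsoids are translates of each other, so that distinct centres would contradict
maximality by the capsule construction.\<close>

lemma maximal_inscribed_unique:
  assumes E1: "inscribed c1 T1 a1" and E2: "inscribed c2 T2 a2"
    and eq: "a2 * \<bar>det T2\<bar> = a1 * \<bar>det T1\<bar>"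
    and max: "\<And>c T a. inscribed c T a \<Longrightarrow> a * \<bar>det T\<bar> \<le> a1 * \<bar>det T1\<bar>"
  shows "a2 = a1" "affine_ball c2 T2 = affine_ball c1 T1"
proof -
  obtain U V d where UV: "orthogonal_matrix U" "orthogonal_matrix V" and d: "\<And>i. 0 < d i"
      and T2U: "T2 ** U = T1 ** V ** diag d"
    using simultaneous_diagonalization E1 E2 unfolding inscribed_def by metis
  define T where "T = T1 ** V"
  have T: "inscribed c1 T a1" "\<bar>det T\<bar> = \<bar>det T1\<bar>"
    unfolding T_def using inscribed_orthogonal[OF E1 UV(2)] abs_det_mult_orthogonal[OF UV(2)] by auto
  have TD: "inscribed c2 (T ** diag d) a2" "\<bar>det (T ** diag d)\<bar> = \<bar>det T2\<bar>"
    unfolding T_def T2U[symmetric]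
    using inscribed_orthogonal[OF E2 UV(1)] abs_det_mult_orthogonal[OF UV(1)] by auto
  have a: "0 < a1" "0 < a2"
    using E1 E2 by (simp_all add: inscribed_def)
  have detT: "0 < \<bar>det T\<bar>"
    by (rule inscribed_det_nonzero[OF T(1)])
  define P where "P = (\<Prod>i\<in>UNIV. (1 + d i) / 2)"
  define D where "D = (\<Prod>i\<in>UNIV. d i)"
  have P: "0 < P" and D: "0 < D"
    unfolding P_def D_def using d by (auto intro!: prod_pos add_pos_pos)
  have "a2 * D * \<bar>det T\<bar> = a1 * \<bar>det T\<bar>"
    using eq TD(2) T(2) D by (simp add: det_mul det_diag abs_mult D_def mult_ac)
  then have a1: "a1 = a2 * D"
    using detT by simp
  have "inscribed (midpoint c1 c2) (T ** diag (\<lambda>i. (1 + d i) / 2)) (sqrt (a1 * a2))"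
    using TD(1) a d by (intro midpoint_inscribed T(1)) (auto simp: inscribed_def less_imp_le)
  from max[OF this] have "sqrt (a1 * a2) * P * \<bar>det T\<bar> \<le> a1 * \<bar>det T\<bar>"
    using P T(2) by (simp add: det_mul det_diag abs_mult P_def mult_ac)
  then have "sqrt (a1 * a2) * P \<le> a1"
    using detT by simp
  then have "(sqrt (a1 * a2) * P)\<^sup>2 \<le> a1\<^sup>2"
    using a P by (intro power_mono) auto
  then have "a2 * P\<^sup>2 \<le> a1"
    using a by (simp add: power_mult_distrib power2_eq_square[of a1])
  then have "P\<^sup>2 \<le> D"
    using a by (simp add: a1)
  then have d1: "d i = 1" for i
    unfolding P_def D_def by (rule eq_1_if_prod_midpoints_le[OF d])
  then have "d = (\<lambda>_. 1)"
    by blast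
  then have "D = 1" "diag d = mat 1"
    by (simp_all add: D_def diag_def mat_def)
  then show aa: "a2 = a1"
    using a1 by simp
  have T2U': "T2 ** U = T"
    using \<open>diag d = mat 1\<close> by (simp add: T2U T_def)
  have "c1 = c2"
  proof (rule ccontr)
    assume "c1 \<noteq> c2"
    moreover have "inscribed c2 T a1"
      using TD(1) aa \<open>diag d = mat 1\<close> by simp
    ultimately obtain T' where "inscribed (midpoint c1 c2) T' a1" "\<bar>det T\<bar> < \<bar>det T'\<bar>"
      using capsule_inscribed[OF T(1)] by blast
    with max[OF this(1)] a T(2) show False by simp
  qed
  then show "affine_ball c2 T2 = affine_ball c1 T1"
    using affine_ball_orthogonal[OF UV(1), of c2 T2] affine_ball_orthogonal[OF UV(2), of c1 T1]
    by (simp add: T2U' T_def)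
qed

lemma ellipsoidal_le_iff_inscribed:
  assumes "0 < a" "invertible T"
  shows "(\<forall>x. ellipsoidal (affine_ball c T) a x \<le> f x) \<longleftrightarrow> inscribed c T a"
  using assms f_nonneg by (auto simp: ellipsoidal_def inscribed_def indicator_def)

lemma integral_ellipsoidal:
  fixes T :: "real ^ 'n ^ 'n"
  assumes "invertible T"
  shows "(\<integral>x. ellipsoidal (affine_ball c T) a x \<partial>lebesgue) = a * \<bar>det T\<bar> * \<kappa>"
  using measure_affine_ball[OF assms, of c] by (simp add: ellipsoidal_def \<kappa>_def)

lemma inscribed_le_sup_norm:
  assumes "inscribed c T a"
  shows "a \<le> sup_norm f"
proof -
  have "a \<le> f (c + T *v 0)"
    using assms unfolding inscribed_def by (metis centre_in_cball zero_le_one)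
  also have "\<dots> \<le> sup_norm f"
    unfolding sup_norm_def by (intro cSUP_upper bdd_above_range) simp
  finally show ?thesis .
qed

end

section \<open>The maximal ellipsoidal function\<close>

theorem theorem1p1:
  fixes f :: "real ^ 'n \<Rightarrow> real"
  assumes "log_concave_fun f"
    and "integrable lebesgue f"
    and "upper_semicontinuous f"
    and "0 < (\<integral>x. f x \<partial>lebesgue)"
  shows "\<exists>g. (\<exists>E t\<^sub>0. ellipsoid E \<and> 0 < t\<^sub>0 \<and> t\<^sub>0 \<le> 1 \<and> g = ellipsoidal E (t\<^sub>0 * sup_norm f)) \<and>
    (\<forall>h. (ellipsoidal_function h \<and>
          (\<forall>x. h x \<le> f x) \<and>
          is_maximum (\<integral>x. h x \<partial>lebesgue)
            {\<integral>x. ellipsoidal E a x \<partial>lebesgue | E a.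
               ellipsoid E \<and> 0 < a \<and> (\<forall>x. ellipsoidal E a x \<le> f x)})
         \<longleftrightarrow> h = g)"
proof -
  interpret integrable_log_concave f
    using assms by unfold_locales
  obtain c T a where E: "inscribed c T a"
      and max: "\<And>c' T' a'. inscribed c' T' a' \<Longrightarrow> a' * \<bar>det T'\<bar> \<le> a * \<bar>det T\<bar>"
    using maximal_inscribed_exists by blast
  have a: "0 < a" and T: "invertible T"
    using E by (simp_all add: inscribed_def)
  define g where "g = ellipsoidal (affine_ball c T) a"
  define V where "V = {\<integral>x. ellipsoidal E a x \<partial>lebesgue | E a.
    ellipsoid E \<and> 0 < a \<and> (\<forall>x. ellipsoidal E a x \<le> f x)}"
  have ellipsoidE: "\<exists>c T. invertible T \<and> E = affine_ball c T" if "ellipsoid E" for E :: "(real ^ 'n) set"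
    using that by (auto simp: ellipsoid_def)
  have ellipsoid: "ellipsoid (affine_ball c T)" if "invertible T" for c and T :: "real ^ 'n ^ 'n"
    using that by (auto simp: ellipsoid_def)
  have int_g: "(\<integral>x. g x \<partial>lebesgue) = a * \<bar>det T\<bar> * \<kappa>"
    unfolding g_def by (rule integral_ellipsoidal[OF T])
  have le_g: "\<forall>x. g x \<le> f x"
    unfolding g_def using E ellipsoidal_le_iff_inscribed[OF a T] by blast
  have g_in: "(\<integral>x. g x \<partial>lebesgue) \<in> V"
    unfolding V_def using a ellipsoid[OF T] le_g by (auto simp: g_def)
  have "s \<le> (\<integral>x. g x \<partial>lebesgue)" if s_in: "s \<in> V" for s
  proof -
    obtain c' T' a' where "0 < a'" "invertible T'" and le: "\<forall>x. ellipsoidal (affine_ball c' T') a' x \<le> f x"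
        and s: "s = (\<integral>x. ellipsoidal (affine_ball c' T') a' x \<partial>lebesgue)"
      using s_in ellipsoidE unfolding V_def by blast
    then have "a' * \<bar>det T'\<bar> \<le> a * \<bar>det T\<bar>"
      by (intro max) (simp add: ellipsoidal_le_iff_inscribed)
    then show ?thesis
      using kappa_pos \<open>invertible T'\<close> by (simp add: s int_g integral_ellipsoidal)
  qed
  then have g_max: "is_maximum (\<integral>x. g x \<partial>lebesgue) V"
    using g_in by (simp add: is_maximum_def)
  have unique: "h = g" if h: "ellipsoidal_function h" "\<forall>x. h x \<le> f x" "is_maximum (\<integral>x. h x \<partial>lebesgue) V" for h
  proof -
    obtain c' T' a' where a': "0 < a'" and T': "invertible T'" and h_eq: "h = ellipsoidal (affine_ball c' T') a'"
      using h(1) ellipsoidE unfolding ellipsoidal_function_def by blast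
    then have E': "inscribed c' T' a'"
      using h(2) ellipsoidal_le_iff_inscribed by simp
    have "(\<integral>x. g x \<partial>lebesgue) \<le> (\<integral>x. h x \<partial>lebesgue)"
      using h(3) g_in by (simp add: is_maximum_def)
    then have "a * \<bar>det T\<bar> \<le> a' * \<bar>det T'\<bar>"
      using kappa_pos T' by (simp add: int_g h_eq integral_ellipsoidal)
    with max[OF E'] have "a' * \<bar>det T'\<bar> = a * \<bar>det T\<bar>" by simp
    from maximal_inscribed_unique[OF E E' this max] show ?thesis
      by (simp add: h_eq g_def)
  qed
  have sup: "a \<le> sup_norm f"
    by (rule inscribed_le_sup_norm[OF E])
  have "\<exists>E t\<^sub>0. ellipsoid E \<and> 0 < t\<^sub>0 \<and> t\<^sub>0 \<le> 1 \<and> g = ellipsoidal E (t\<^sub>0 * sup_norm f)"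
    using a sup ellipsoid[OF T]
    by (intro exI[of _ "affine_ball c T"] exI[of _ "a / sup_norm f"]) (simp add: g_def)
  moreover have "ellipsoidal_function g"
    using a ellipsoid[OF T] by (auto simp: ellipsoidal_function_def g_def)
  ultimately show ?thesis
    unfolding V_def[symmetric] using unique le_g g_max by blast
qed

end
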